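(* Let $\rho$ be a Borel probability measure on $\mathbb{R}$ having an exponential moment of order $\eta>0$ and a positive drift $\lambda=\int_{\mathbb{R}} y\,d\rho(y)>0$. Then there is $s_0\in(0,\eta]$ such that for every real $l\geq 0$, $\rho$ is $l$-weakly-diophantine if and only if there is a real $C>0$ such that $0$ is the only zero of $1-\widehat\rho$ in $$\left\{z\in\mathbb{C} \;:\; \Re(z)\in(-s_0,s_0)\ \text{ and }\ \Re(z)\geq \frac{-C}{1+|\Im(z)|^{l}}\right\}.$$
   Context: $\rho$ has an exponential moment of order $\eta>0$ if $\int_{\mathbb{R}} e^{\eta|y|}\,d\rho(y)<+\infty$. For $z\in\mathbb{C}$ with $|\Re(z)|<\eta$, the Fourier-Laplace transform is $\widehat\rho(z)=\int_{\mathbb{R}} e^{-zy}\,d\rho(y)$. For real $l\geq 0$, $\rho$ is called $l$-weakly-diophantine if $\liminf_{b\to\pm\infty}|b|^l\,|1-\widehat\rho(ib)|>0$ ($b$ real). *)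

theory Defs
  imports "HOL-Probability.Probability"
begin

definition exponential_moment :: "real measure \<Rightarrow> real \<Rightarrow> bool" where
  "exponential_moment \<rho> \<eta> \<longleftrightarrow> (\<integral>\<^sup>+ y. ennreal (exp (\<eta> * \<bar>y\<bar>)) \<partial>\<rho>) < \<infinity>"

(* Meaningful where the integrand is integrable, in particular for \<bar>Re z\<bar> < \<eta> when
   the measure has an exponential moment of order \<eta>. *)
definition fourier_laplace :: "real measure \<Rightarrow> complex \<Rightarrow> complex" where
  "fourier_laplace \<rho> z = (\<integral>y. exp (- z * complex_of_real y) \<partial>\<rho>)"

(* The power x ^ l of a real x \<ge> 0 to a real exponent l \<ge> 0, with the usual convention
   that x ^ 0 = 1 also at x = 0; note that 0 powr 0 = 0. *)
definition nonneg_power :: "real \<Rightarrow> real \<Rightarrow> real" where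
  "nonneg_power x l = (if l = 0 then 1 else x powr l)"

definition weakly_diophantine :: "real \<Rightarrow> real measure \<Rightarrow> bool" where
  "weakly_diophantine l \<rho> \<longleftrightarrow>
     0 < Liminf (sup at_top at_bot)
           (\<lambda>b::real. ereal (nonneg_power \<bar>b\<bar> l * cmod (1 - fourier_laplace \<rho> (\<i> * complex_of_real b))))"

definition zero_free_region :: "real \<Rightarrow> real \<Rightarrow> real \<Rightarrow> complex set" where
  "zero_free_region s C l =
     {z. Re z \<in> {- s<..<s} \<and> Re z \<ge> - C / (1 + nonneg_power \<bar>Im z\<bar> l)}"

end

theory Submission
  imports Defs
begin

text \<open>
  Write \<open>f = 1 - \<rho>\<close>-hat and \<open>\<mu> > 0\<close> for the drift, so that \<open>f z = \<mu> z + O(z^2)\<close> near 0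
  and \<open>f\<close> is Lipschitz on vertical strips.
  A lower bound for \<open>f\<close> on the imaginary axis therefore excludes zeros within a comparable
  distance to the left of the axis; to the right there are none since
  \<open>\<integral>exp (-a y) d\<rho> < 1\<close> for small \<open>a > 0\<close>. On bounded parts of the axis
  the lower bound comes from compactness, because a zero \<open>\<i> b \<noteq> 0\<close> would yield the zeros
  \<open>\<i> n b\<close> and contradict the diophantine condition.
  Conversely, if \<open>\<epsilon> = \<bar>f (\<i> b)\<bar>\<close> is small, then \<open>exp (-\<i> b y)\<close> is close to 1 for \<open>\<rho>\<close>-most \<open>y\<close>,
  hence the derivative of \<open>f\<close> near \<open>\<i> b\<close> is close to \<open>\<mu>\<close>, and the map \<open>z - f z / \<mu>\<close>
  is a contraction of the disc of radius \<open>2 \<epsilon> / \<mu>\<close> around \<open>\<i> b\<close>. Its fixed point is a zero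
  of \<open>f\<close>, which a zero-free region forbids unless \<open>\<epsilon>\<close> is large enough.
\<close>

section \<open>Pointwise estimates for the kernel \<open>exp (- z * y)\<close>\<close>

lemma norm_exp_mult_real_le:
  assumes "\<bar>Re z\<bar> \<le> s"
  shows "norm (exp (- z * complex_of_real y)) \<le> exp (s * \<bar>y\<bar>)"
proof -
  have "- Re z * y \<le> \<bar>Re z\<bar> * \<bar>y\<bar>"
    by (metis abs_ge_self abs_minus_cancel abs_mult)
  also have "\<dots> \<le> s * \<bar>y\<bar>"
    using assms by (intro mult_right_mono) auto
  finally show ?thesis by (simp add: norm_exp_eq_Re)
qed

text \<open>Mean value inequality on the convex strip where \<bar>Re u\<bar> is at most
  \<open>s\<close>: there the derivative of the kernel in \<open>u\<close> is at most
  \<open>\<bar>y\<bar> * exp (s * \<bar>y\<bar>)\<close>.\<close>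

lemma norm_exp_diff_le:
  assumes "\<bar>Re z\<bar> \<le> s" "\<bar>Re w\<bar> \<le> s"
  shows "norm (exp (- z * complex_of_real y) - exp (- w * complex_of_real y))
           \<le> norm (z - w) * (\<bar>y\<bar> * exp (s * \<bar>y\<bar>))"
proof -
  let ?S = "{u. - s \<le> Re u} \<inter> {u. Re u \<le> s}"
  have "norm (exp (- z * complex_of_real y) - exp (- w * complex_of_real y))
          \<le> (\<bar>y\<bar> * exp (s * \<bar>y\<bar>)) * norm (z - w)"
  proof (rule field_differentiable_bound[where S = ?S
        and f = "\<lambda>u. exp (- u * complex_of_real y)"])
    show "convex ?S"
      by (intro convex_Int convex_halfspace_Re_ge convex_halfspace_Re_le)
    fix u assume u: "u \<in> ?S"
    show "((\<lambda>u. exp (- u * complex_of_real y)) has_field_derivative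
            exp (- u * complex_of_real y) * (- complex_of_real y)) (at u within ?S)"
      by (auto intro!: derivative_eq_intros)
    have "norm (exp (- u * complex_of_real y)) \<le> exp (s * \<bar>y\<bar>)"
      using u by (intro norm_exp_mult_real_le) auto
    then show "norm (exp (- u * complex_of_real y) * (- complex_of_real y)) \<le> \<bar>y\<bar> * exp (s * \<bar>y\<bar>)"
      by (simp add: norm_mult mult.commute mult_left_mono)
  qed (use assms in auto)
  then show ?thesis by (simp add: mult.commute)
qed

text \<open>Mean value inequality for \<open>?h\<close>, whose derivative is
  \<open>y * (exp (- u * y) - 1)\<close>. That derivative is compared with its value at the centre
  \<open>\<i> * b\<close>: the variation over the disc gives the term with \<open>r\<close>, the
  central value gives the other one.\<close>

lemma norm_exp_diff_linear_le:
  fixes b r s y :: real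
  assumes "r \<le> s" "z \<in> cball (\<i> * of_real b) r" "w \<in> cball (\<i> * of_real b) r"
  shows "norm (exp (- w * complex_of_real y) - exp (- z * complex_of_real y) - (z - w) * of_real y)
     \<le> norm (z - w) * (r * (y\<^sup>2 * exp (s * \<bar>y\<bar>))
         + \<bar>y\<bar> * norm (exp (- (\<i> * of_real b) * complex_of_real y) - 1))"
proof -
  let ?S = "cball (\<i> * complex_of_real b) r"
  let ?e = "norm (exp (- (\<i> * of_real b) * complex_of_real y) - 1)"
  let ?h = "\<lambda>u. - exp (- u * complex_of_real y) - u * complex_of_real y"
  have "norm (?h z - ?h w) \<le> (r * (y\<^sup>2 * exp (s * \<bar>y\<bar>)) + \<bar>y\<bar> * ?e) * norm (z - w)"
  proof (rule field_differentiable_bound[where S = ?S and f = ?h])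
    show "convex ?S" by simp
    fix u assume u: "u \<in> ?S"
    show "(?h has_field_derivative complex_of_real y * (exp (- u * complex_of_real y) - 1)) (at u within ?S)"
      by (auto intro!: derivative_eq_intros simp: algebra_simps)
    have ur: "norm (u - \<i> * of_real b) \<le> r"
      using u by (simp add: dist_norm norm_minus_commute)
    have "\<bar>Re u\<bar> \<le> r"
      using order_trans[OF abs_Re_le_cmod ur] by simp
    moreover have "0 \<le> r" using ur norm_ge_zero order_trans by blast
    ultimately have "norm (exp (- u * complex_of_real y) - exp (- (\<i> * of_real b) * complex_of_real y))
       \<le> norm (u - \<i> * of_real b) * (\<bar>y\<bar> * exp (s * \<bar>y\<bar>))"
      using assms(1) by (intro norm_exp_diff_le) auto
    also have "\<dots> \<le> r * (\<bar>y\<bar> * exp (s * \<bar>y\<bar>))"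
      using ur by (intro mult_right_mono) auto
    finally have "norm (exp (- u * complex_of_real y) - 1) \<le> r * (\<bar>y\<bar> * exp (s * \<bar>y\<bar>)) + ?e"
      using norm_triangle_ineq[of "exp (- u * complex_of_real y) - exp (- (\<i> * of_real b) * complex_of_real y)"
          "exp (- (\<i> * of_real b) * complex_of_real y) - 1"] by simp
    then have "\<bar>y\<bar> * norm (exp (- u * complex_of_real y) - 1)
        \<le> \<bar>y\<bar> * (r * (\<bar>y\<bar> * exp (s * \<bar>y\<bar>)) + ?e)"
      by (intro mult_left_mono) auto
    also have "\<dots> = r * ((\<bar>y\<bar> * \<bar>y\<bar>) * exp (s * \<bar>y\<bar>)) + \<bar>y\<bar> * ?e"
      by (simp only: distrib_left mult_ac)
    finally show "norm (complex_of_real y * (exp (- u * complex_of_real y) - 1))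
        \<le> r * (y\<^sup>2 * exp (s * \<bar>y\<bar>)) + \<bar>y\<bar> * ?e"
      by (simp add: norm_mult power2_eq_square)
  qed (use assms in auto)
  then show ?thesis by (simp add: algebra_simps)
qed

text \<open>Links the distance of the kernel from 1 to \<open>1 - cos (b * y)\<close>, whose
  integral is the real part of \<open>f\<close> at \<open>\<i> * b\<close>.\<close>

lemma norm_exp_minus_one_sq:
  fixes b y :: real
  shows
  "(norm (exp (- (\<i> * of_real b) * complex_of_real y) - 1))\<^sup>2 = 2 * (1 - cos (b * y))"
proof -
  have "(norm (exp (- (\<i> * of_real b) * complex_of_real y) - 1))\<^sup>2
      = (cos (b * y) - 1)\<^sup>2 + (sin (b * y))\<^sup>2"
    by (simp add: cmod_power2 Re_exp Im_exp)
  also have "\<dots> = ((sin (b * y))\<^sup>2 + (cos (b * y))\<^sup>2) + 1 - 2 * cos (b * y)"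
    by (simp add: power2_eq_square algebra_simps)
  finally show ?thesis by simp
qed

section \<open>Powers, and the liminf condition as an explicit lower bound\<close>

lemma nonneg_power_nonneg: "0 \<le> nonneg_power x l"
  by (simp add: nonneg_power_def)

lemma nonneg_power_ge_one: "1 \<le> x \<Longrightarrow> 0 \<le> l \<Longrightarrow> 1 \<le> nonneg_power x l"
  by (auto simp: nonneg_power_def ge_one_powr_ge_zero)

text \<open>Lets the weight at the height of a zero be replaced by the weight at the nearby point
  \<open>b\<close> of the axis, at the cost of a constant factor.\<close>

lemma nonneg_power_le_double:
  assumes "0 \<le> x" "x \<le> 2 * b" "0 \<le> l"
  shows "nonneg_power x l \<le> 2 powr l * nonneg_power b l"
proof (cases "l = 0")
  case False
  then have "x powr l \<le> (2 * b) powr l" using assms by (intro powr_mono2) auto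
  then show ?thesis using False assms by (simp add: nonneg_power_def powr_mult)
qed (simp add: nonneg_power_def)

lemma weakly_diophantine_iff:
  "weakly_diophantine l \<rho> \<longleftrightarrow>
    (\<exists>c>0. \<exists>B. \<forall>b. B \<le> \<bar>b\<bar> \<longrightarrow>
       c \<le> nonneg_power \<bar>b\<bar> l * cmod (1 - fourier_laplace \<rho> (\<i> * complex_of_real b)))"
    (is "_ \<longleftrightarrow> (\<exists>c>0. \<exists>B. \<forall>b. _ \<longrightarrow> c \<le> ?g b)")
proof
  assume "weakly_diophantine l \<rho>"
  then have "0 < Liminf (sup at_top at_bot) (\<lambda>b. ereal (?g b))"
    by (simp add: weakly_diophantine_def)
  \<comment> \<open>The liminf may be infinite, so a real number strictly between 0 and it is
    taken.\<close>
  then obtain c where c: "0 < ereal c" "ereal c < Liminf (sup at_top at_bot) (\<lambda>b. ereal (?g b))"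
    using ereal_dense2 by blast
  then have "eventually (\<lambda>b. ereal c < ereal (?g b)) (sup at_top at_bot)"
    by (intro less_LiminfD)
  then have "eventually (\<lambda>b. c < ?g b) at_top" "eventually (\<lambda>b. c < ?g b) at_bot"
    by (auto simp: eventually_sup)
  then obtain B1 B2 where B: "\<And>b. B1 \<le> b \<Longrightarrow> c < ?g b" "\<And>b. b \<le> B2 \<Longrightarrow> c < ?g b"
    by (auto simp: eventually_at_top_linorder eventually_at_bot_linorder)
  have "c \<le> ?g b" if "max \<bar>B1\<bar> \<bar>B2\<bar> \<le> \<bar>b\<bar>" for b
  proof (cases "0 \<le> b")
    case True
    then show ?thesis using that by (intro less_imp_le[OF B(1)]) auto
  next
    case False
    then show ?thesis using that by (intro less_imp_le[OF B(2)]) auto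
  qed
  then show "\<exists>c>0. \<exists>B. \<forall>b. B \<le> \<bar>b\<bar> \<longrightarrow> c \<le> ?g b"
    using c(1) unfolding ereal_less(2) by blast
next
  assume "\<exists>c>0. \<exists>B. \<forall>b. B \<le> \<bar>b\<bar> \<longrightarrow> c \<le> ?g b"
  then obtain c B where c: "c > 0" and B: "\<And>b. B \<le> \<bar>b\<bar> \<Longrightarrow> c \<le> ?g b" by blast
  have "eventually (\<lambda>b. c \<le> ?g b) at_top"
    unfolding eventually_at_top_linorder by (rule exI[of _ "\<bar>B\<bar>"]) (intro allI impI B, linarith)
  moreover have "eventually (\<lambda>b. c \<le> ?g b) at_bot"
    unfolding eventually_at_bot_linorder by (rule exI[of _ "- \<bar>B\<bar>"]) (intro allI impI B, linarith)
  ultimately have "eventually (\<lambda>b. ereal c \<le> ereal (?g b)) (sup at_top at_bot)"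
    by (auto simp: eventually_sup)
  then have "ereal c \<le> Liminf (sup at_top at_bot) (\<lambda>b. ereal (?g b))"
    by (rule Liminf_bounded)
  moreover have "0 < ereal c" using c by simp
  ultimately show "weakly_diophantine l \<rho>"
    unfolding weakly_diophantine_def by (rule less_le_trans[rotated])
qed

section \<open>The transform on a vertical strip: Lipschitz bound and linear approximation\<close>

text \<open>One constant \<open>D\<close> bounds both weighted moments: the first makes it a
  Lipschitz constant of \<open>f\<close> on the strip, the second controls how fast the derivative
  of \<open>f\<close> varies.\<close>

locale drift_measure = prob_space \<rho> for \<rho> :: "real measure" +
  fixes s D \<mu> :: real
  assumes sets_eq [measurable_cong, simp]: "sets \<rho> = sets borel"
    and s_pos: "0 < s" and D_pos: "0 < D" and drift_pos: "0 < \<mu>"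
    and drift: "\<mu> = (\<integral>y. y \<partial>\<rho>)"
    and int_exp: "integrable \<rho> (\<lambda>y. exp (s * \<bar>y\<bar>))"
    and int_abs: "integrable \<rho> (\<lambda>y. \<bar>y\<bar> * exp (s * \<bar>y\<bar>))"
    and int_sq: "integrable \<rho> (\<lambda>y. y\<^sup>2 * exp (s * \<bar>y\<bar>))"
    and abs_le_D: "(\<integral>y. \<bar>y\<bar> * exp (s * \<bar>y\<bar>) \<partial>\<rho>) \<le> D"
    and sq_le_D: "(\<integral>y. y\<^sup>2 * exp (s * \<bar>y\<bar>) \<partial>\<rho>) \<le> D"
begin

abbreviation f :: "complex \<Rightarrow> complex" where
  "f z \<equiv> 1 - fourier_laplace \<rho> z"

lemma integrable_id: "integrable \<rho> (\<lambda>y. y)"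
proof (rule Bochner_Integration.integrable_bound[OF int_abs])
  show "AE y in \<rho>. norm y \<le> norm (\<bar>y\<bar> * exp (s * \<bar>y\<bar>))"
    using s_pos by (auto simp: abs_mult mult_le_cancel_left1)
qed simp

lemma integrable_square: "integrable \<rho> (\<lambda>y. y\<^sup>2)"
proof (rule Bochner_Integration.integrable_bound[OF int_sq])
  show "AE y in \<rho>. norm (y\<^sup>2) \<le> norm (y\<^sup>2 * exp (s * \<bar>y\<bar>))"
    using s_pos by (auto simp: abs_mult mult_le_cancel_left1)
qed simp

lemma integral_square_le: "(\<integral>y. y\<^sup>2 \<partial>\<rho>) \<le> D"
proof -
  have "(\<integral>y. y\<^sup>2 \<partial>\<rho>) \<le> (\<integral>y. y\<^sup>2 * exp (s * \<bar>y\<bar>) \<partial>\<rho>)"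
    using s_pos by (intro integral_mono integrable_square int_sq) (auto simp: mult_le_cancel_left1)
  then show ?thesis using sq_le_D by simp
qed

lemma integrable_fl:
  assumes "\<bar>Re z\<bar> \<le> s"
  shows "integrable \<rho> (\<lambda>y. exp (- z * complex_of_real y))"
proof (rule Bochner_Integration.integrable_bound[OF int_exp])
  show "AE y in \<rho>. norm (exp (- z * complex_of_real y)) \<le> norm (exp (s * \<bar>y\<bar>))"
    using norm_exp_mult_real_le[OF assms] by simp
qed simp

lemma f_zero: "f 0 = 0"
  by (simp add: fourier_laplace_def prob_space)

lemma f_diff:
  assumes "\<bar>Re z\<bar> \<le> s" "\<bar>Re w\<bar> \<le> s"
  shows "f z - f w = (\<integral>y. exp (- w * complex_of_real y) - exp (- z * complex_of_real y) \<partial>\<rho>)"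
  unfolding fourier_laplace_def
  by (subst Bochner_Integration.integral_diff) (intro integrable_fl assms | simp)+

lemma f_lipschitz:
  assumes "\<bar>Re z\<bar> \<le> s" "\<bar>Re w\<bar> \<le> s"
  shows "norm (f z - f w) \<le> norm (z - w) * D"
proof -
  have "norm (f z - f w) \<le> (\<integral>y. norm (exp (- w * complex_of_real y) - exp (- z * complex_of_real y)) \<partial>\<rho>)"
    unfolding f_diff[OF assms] by (rule integral_norm_bound)
  also have "\<dots> \<le> (\<integral>y. norm (z - w) * (\<bar>y\<bar> * exp (s * \<bar>y\<bar>)) \<partial>\<rho>)"
  proof (rule integral_mono)
    show "norm (exp (- w * complex_of_real y) - exp (- z * complex_of_real y))
            \<le> norm (z - w) * (\<bar>y\<bar> * exp (s * \<bar>y\<bar>))" for y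
      using norm_exp_diff_le[OF assms(2,1)] by (simp add: norm_minus_commute)
  qed (intro integrable_norm Bochner_Integration.integrable_diff integrable_fl assms
      integrable_mult_right int_abs)+
  also have "\<dots> = norm (z - w) * (\<integral>y. \<bar>y\<bar> * exp (s * \<bar>y\<bar>) \<partial>\<rho>)" by simp
  also have "\<dots> \<le> norm (z - w) * D" using abs_le_D by (intro mult_left_mono) auto
  finally show ?thesis .
qed

text \<open>Bounds the distance of the derivative of \<open>f\<close> at \<open>\<i> b\<close> from its value \<open>\<mu>\<close> at 0.\<close>

definition defect :: "real \<Rightarrow> real" where
  "defect b = (\<integral>y. \<bar>y\<bar> * norm (exp (- (\<i> * of_real b) * complex_of_real y) - 1) \<partial>\<rho>)"

lemma defect_0: "defect 0 = 0"
  by (simp add: defect_def)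

lemma integrable_defect:
  "integrable \<rho> (\<lambda>y. \<bar>y\<bar> * norm (exp (- (\<i> * of_real b) * complex_of_real y) - 1))"
proof (rule Bochner_Integration.integrable_bound[where f = "\<lambda>y. 2 * y"])
  have "norm (exp (- (\<i> * of_real b) * complex_of_real y) - 1) \<le> 2" for y
    using norm_triangle_ineq4[of "exp (- (\<i> * of_real b) * complex_of_real y)" 1]
    by (simp add: norm_exp_eq_Re)
  then have "\<bar>y\<bar> * norm (exp (- (\<i> * of_real b) * complex_of_real y) - 1) \<le> \<bar>y\<bar> * 2" for y
    by (intro mult_left_mono) auto
  then show "AE y in \<rho>. norm (\<bar>y\<bar> * norm (exp (- (\<i> * of_real b) * complex_of_real y) - 1)) \<le> norm (2 * y)"
    by (simp only: abs_mult real_norm_def abs_idempotent abs_norm_cancel abs_numeral mult.commute AE_I2)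
  show "integrable \<rho> (\<lambda>y. 2 * y)" using integrable_id by simp
qed simp

text \<open>The pointwise estimate is integrated; the linear term integrates to
  \<open>\<mu> * (z - w)\<close> because \<mu> is the mean. Here \<open>r * D\<close> accounts for
  the variation of the derivative over the disc and \<open>defect b\<close> for its deviation from
  \<mu> at the centre.\<close>

lemma f_linear_approx:
  assumes "r \<le> s" "z \<in> cball (\<i> * of_real b) r" "w \<in> cball (\<i> * of_real b) r"
  shows "norm (f z - f w - of_real \<mu> * (z - w)) \<le> norm (z - w) * (r * D + defect b)"
proof -
  have Re: "\<bar>Re u\<bar> \<le> s" if "u \<in> cball (\<i> * of_real b) r" for u
    using that order_trans[OF abs_Re_le_cmod[of "u - \<i> * of_real b"]] assms(1)
    by (force simp: dist_norm norm_minus_commute)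
  have r: "0 \<le> r" using assms(2) by (metis mem_cball zero_le_dist order_trans)
  let ?F = "\<lambda>y. exp (- w * complex_of_real y) - exp (- z * complex_of_real y) - (z - w) * of_real y"
  have iF: "integrable \<rho> ?F"
    by (intro Bochner_Integration.integrable_diff integrable_fl Re assms
        integrable_mult_right integrable_of_real integrable_id)
  have "(\<integral>y. (z - w) * complex_of_real y \<partial>\<rho>) = of_real \<mu> * (z - w)"
    unfolding drift by (simp add: mult.commute)
  then have "f z - f w - of_real \<mu> * (z - w) = (\<integral>y. ?F y \<partial>\<rho>)"
    unfolding f_diff[OF Re[OF assms(2)] Re[OF assms(3)]]
    by (subst (2) Bochner_Integration.integral_diff)
      (intro Bochner_Integration.integrable_diff integrable_fl Re assms
        integrable_mult_right integrable_of_real integrable_id refl | simp only:)+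
  then have "norm (f z - f w - of_real \<mu> * (z - w)) \<le> (\<integral>y. norm (?F y) \<partial>\<rho>)"
    using integral_norm_bound[of \<rho> ?F] by (simp only:)
  also have "\<dots> \<le> (\<integral>y. norm (z - w) * (r * (y\<^sup>2 * exp (s * \<bar>y\<bar>))
         + \<bar>y\<bar> * norm (exp (- (\<i> * of_real b) * complex_of_real y) - 1)) \<partial>\<rho>)"
    by (intro integral_mono integrable_norm iF norm_exp_diff_linear_le[OF assms]
        integrable_mult_right Bochner_Integration.integrable_add int_sq integrable_defect)
  also have "\<dots> = norm (z - w) * (r * (\<integral>y. y\<^sup>2 * exp (s * \<bar>y\<bar>) \<partial>\<rho>) + defect b)"
    unfolding defect_def
    by (simp only: integral_mult_right_zero Bochner_Integration.integral_add
        integrable_mult_right int_sq integrable_defect)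
  also have "\<dots> \<le> norm (z - w) * (r * D + defect b)"
    using sq_le_D r by (intro mult_left_mono add_mono) auto
  finally show ?thesis .
qed

section \<open>Small values of \<open>f\<close> on the imaginary axis force nearby zeros\<close>

lemma integral_one_minus_cos:
  "integrable \<rho> (\<lambda>y. 1 - cos (b * y))"
  "(\<integral>y. 1 - cos (b * y) \<partial>\<rho>) = Re (f (\<i> * of_real b))"
proof -
  have i: "integrable \<rho> (\<lambda>y. exp (- (\<i> * of_real b) * complex_of_real y))"
    using s_pos by (intro integrable_fl) auto
  have Re: "Re (exp (- (\<i> * of_real b) * complex_of_real y)) = cos (b * y)" for y
    by (simp add: Re_exp)
  have c: "integrable \<rho> (\<lambda>y. cos (b * y))"
    using integrable_Re[OF i] by (simp only: Re)
  then show "integrable \<rho> (\<lambda>y. 1 - cos (b * y))" by simp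
  have "Re (fourier_laplace \<rho> (\<i> * of_real b)) = (\<integral>y. cos (b * y) \<partial>\<rho>)"
    unfolding fourier_laplace_def integral_Re[OF i, symmetric] by (simp only: Re)
  then show "(\<integral>y. 1 - cos (b * y) \<partial>\<rho>) = Re (f (\<i> * of_real b))"
    using c by (simp add: prob_space)
qed

text \<open>A weighted AM-GM inequality bounds the integrand by \<open>t * y\<^sup>2\<close> plus
  \<open>(1 - cos (b * y)) / (2 * t)\<close>; the second term integrates to a multiple of the real
  part of \<open>f\<close>. The parameter \<open>t\<close> stays free so that the two terms can be
  balanced.\<close>

lemma defect_le:
  assumes "0 < t"
  shows "defect b \<le> t * D + norm (f (\<i> * of_real b)) / (2 * t)"
proof -
  have "defect b \<le> (\<integral>y. t * y\<^sup>2 + (1 - cos (b * y)) / (2 * t) \<partial>\<rho>)"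
    unfolding defect_def
  proof (intro integral_mono integrable_defect Bochner_Integration.integrable_add
      integrable_mult_right integrable_square integrable_divide integral_one_minus_cos)
    fix y
    let ?e = "norm (exp (- (\<i> * of_real b) * complex_of_real y) - 1)"
    have "0 \<le> (2 * t * \<bar>y\<bar> - ?e)\<^sup>2" by simp
    also have "\<dots> = 4 * t * (t * y\<^sup>2 - \<bar>y\<bar> * ?e) + ?e\<^sup>2"
      by (simp add: power2_eq_square algebra_simps)
    finally have "0 \<le> 4 * t * (t * y\<^sup>2 - \<bar>y\<bar> * ?e) + 2 * (1 - cos (b * y))"
      unfolding norm_exp_minus_one_sq .
    then have "0 \<le> (4 * t * (t * y\<^sup>2 - \<bar>y\<bar> * ?e) + 2 * (1 - cos (b * y))) / (4 * t)"
      using assms by (intro divide_nonneg_pos) auto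
    also have "\<dots> = t * y\<^sup>2 - \<bar>y\<bar> * ?e + (1 - cos (b * y)) / (2 * t)"
      using assms by (simp add: field_simps)
    finally show "\<bar>y\<bar> * ?e \<le> t * y\<^sup>2 + (1 - cos (b * y)) / (2 * t)" by simp
  qed
  also have "\<dots> = t * (\<integral>y. y\<^sup>2 \<partial>\<rho>) + Re (f (\<i> * of_real b)) / (2 * t)"
    unfolding integral_one_minus_cos(2)[symmetric]
    by (subst Bochner_Integration.integral_add)
      (intro integrable_mult_right integrable_square integrable_divide integral_one_minus_cos | simp)+
  also have "\<dots> \<le> t * D + norm (f (\<i> * of_real b)) / (2 * t)"
    using assms integral_square_le by (intro add_mono mult_left_mono divide_right_mono complex_Re_le_cmod) auto
  finally show ?thesis .
qed

lemma ex_zero_near: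
  assumes "norm (f (\<i> * of_real b)) \<le> \<mu>\<^sup>2 / (32 * D)" "2 * norm (f (\<i> * of_real b)) / \<mu> \<le> s"
  shows "\<exists>z. norm (z - \<i> * of_real b) \<le> 2 * norm (f (\<i> * of_real b)) / \<mu> \<and> f z = 0"
proof -
  define \<epsilon> where "\<epsilon> = norm (f (\<i> * of_real b))"
  define r where "r = 2 * \<epsilon> / \<mu>"
  define T where "T z = z - f z / of_real \<mu>" for z
  let ?S = "cball (\<i> * complex_of_real b) r"
  have e: "0 \<le> \<epsilon>" "\<epsilon> \<le> \<mu>\<^sup>2 / (32 * D)" using assms by (auto simp: \<epsilon>_def)
  have r: "0 \<le> r" "r \<le> s" using assms drift_pos by (auto simp: r_def \<epsilon>_def)
  have "r * D = 2 * D / \<mu> * \<epsilon>" by (simp add: r_def)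
  also have "\<dots> \<le> 2 * D / \<mu> * (\<mu>\<^sup>2 / (32 * D))"
    using e D_pos drift_pos by (intro mult_left_mono) auto
  also have "\<dots> = \<mu> / 16" using D_pos drift_pos by (simp add: field_simps power2_eq_square)
  finally have rD: "r * D \<le> \<mu> / 16" .
  \<comment> \<open>The choice \<open>t = \<mu> / (8 * D)\<close> makes each of the two terms at
    most \<open>\<mu> / 8\<close> under the assumed bound on \<epsilon>. With \<open>r * D\<close>
    at most \<open>\<mu> / 16\<close> the sum stays below \<open>\<mu> / 2\<close>, which gives
    contraction factor 1/2.\<close>
  have "defect b \<le> \<mu> / (8 * D) * D + \<epsilon> / (2 * (\<mu> / (8 * D)))"
    unfolding \<epsilon>_def using D_pos drift_pos by (intro defect_le) auto
  also have "\<dots> = \<mu> / 8 + 4 * D / \<mu> * \<epsilon>" using D_pos drift_pos by (simp add: field_simps)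
  also have "4 * D / \<mu> * \<epsilon> \<le> 4 * D / \<mu> * (\<mu>\<^sup>2 / (32 * D))"
    using e D_pos drift_pos by (intro mult_left_mono) auto
  also have "4 * D / \<mu> * (\<mu>\<^sup>2 / (32 * D)) = \<mu> / 8"
    using D_pos drift_pos by (simp add: field_simps power2_eq_square)
  finally have small: "r * D + defect b \<le> \<mu> / 2" using rD drift_pos by simp
  have contr: "dist (T z) (T w) \<le> 1 / 2 * dist z w" if "z \<in> ?S" "w \<in> ?S" for z w
  proof -
    have "T z - T w = - ((f z - f w - of_real \<mu> * (z - w)) / of_real \<mu>)"
      using drift_pos by (simp add: T_def field_simps)
    then have "dist (T z) (T w) = norm (f z - f w - of_real \<mu> * (z - w)) / \<mu>"
      using drift_pos by (simp only: dist_norm norm_minus_cancel norm_divide norm_of_real abs_of_pos)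
    also have "\<dots> \<le> norm (z - w) * (\<mu> / 2) / \<mu>"
      using drift_pos order_trans[OF f_linear_approx[OF r(2) that] mult_left_mono[OF small]]
      by (intro divide_right_mono) auto
    finally show ?thesis using drift_pos by (simp add: dist_norm)
  qed
  have "\<exists>!x\<in>?S. T x = x"
  proof (rule Banach_fix[OF compact_imp_complete[OF compact_cball], where c = "1/2"])
    show "?S \<noteq> {}" using r by auto
    \<comment> \<open>The centre moves by exactly \<open>r / 2\<close>, and contraction keeps every
      image within another \<open>r / 2\<close> of the moved centre. This is why the radius is twice
      \<epsilon>/\<mu>.\<close>
    show "T ` ?S \<subseteq> ?S"
    proof
      fix u assume "u \<in> T ` ?S"
      then obtain z where z: "z \<in> ?S" "u = T z" by auto
      have "dist (T (\<i> * of_real b)) (\<i> * of_real b) = r / 2"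
        using drift_pos by (simp add: T_def dist_norm norm_divide r_def \<epsilon>_def)
      moreover have "dist (T z) (T (\<i> * of_real b)) \<le> 1 / 2 * r"
        using contr[OF z(1), of "\<i> * of_real b"] z(1) r by (simp add: dist_commute)
      ultimately show "u \<in> ?S"
        using dist_triangle[of "T z" "\<i> * of_real b" "T (\<i> * of_real b)"] z(2)
        by (simp add: dist_commute)
    qed
  qed (use contr in auto)
  then obtain z where "z \<in> ?S" "T z = z" by blast
  then show ?thesis
    using drift_pos by (auto simp: T_def r_def \<epsilon>_def dist_norm norm_minus_commute intro!: exI[of _ z])
qed

section \<open>Zeros near 0, to the right of the axis, and on the axis\<close>

text \<open>The first bound keeps the disc of radius \<open>2 * s\<^sub>0\<close> around 0 inside
  the strip; the second keeps the quadratic error there below the linear term. That disc contains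
  the square of half-side \<open>s\<^sub>0\<close>.\<close>

definition s\<^sub>0 :: real where "s\<^sub>0 = min (s / 2) (\<mu> / (4 * D))"

lemma s0_pos: "0 < s\<^sub>0" and s0_le: "2 * s\<^sub>0 \<le> s" and s0_D: "2 * s\<^sub>0 * D < \<mu>"
proof -
  show "0 < s\<^sub>0" "2 * s\<^sub>0 \<le> s" using s_pos D_pos drift_pos by (auto simp: s\<^sub>0_def)
  have "s\<^sub>0 \<le> \<mu> / (4 * D)" by (simp add: s\<^sub>0_def)
  then have "4 * s\<^sub>0 * D \<le> \<mu>" using D_pos by (simp add: field_simps)
  then show "2 * s\<^sub>0 * D < \<mu>" using drift_pos by simp
qed

lemma f_near_0:
  assumes "norm z \<le> 2 * s\<^sub>0"
  shows "norm (f z - of_real \<mu> * z) \<le> norm z * (2 * s\<^sub>0 * D)"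
  using f_linear_approx[of "2 * s\<^sub>0" z 0 0] s0_pos s0_le assms by (simp add: defect_0 f_zero)

lemma f_eq_0_near_0:
  assumes "norm z \<le> 2 * s\<^sub>0" "f z = 0"
  shows "z = 0"
proof (rule ccontr)
  assume "z \<noteq> 0"
  then have "norm z * (2 * s\<^sub>0 * D) < norm z * \<mu>" using s0_D by simp
  then show False using f_near_0[OF assms(1)] assms(2) drift_pos
    by (simp add: norm_mult mult.commute)
qed

text \<open>The modulus of the transform at \<open>z\<close> is at most its value at
  \<open>Re z\<close>, so a zero would give \<open>Re (f ?a) \<le> 0\<close>. The linear
  approximation at 0 instead makes \<open>f\<close> positive at small positive reals.\<close>

lemma f_nonzero_right:
  assumes "0 < Re z" "Re z < s\<^sub>0"
  shows "f z \<noteq> 0"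
proof
  assume z: "f z = 0"
  let ?a = "complex_of_real (Re z)"
  have a: "\<bar>Re z\<bar> \<le> s" using assms s0_le by simp
  have "1 = norm (fourier_laplace \<rho> z)" using z by simp
  also have "\<dots> \<le> (\<integral>y. norm (exp (- z * complex_of_real y)) \<partial>\<rho>)"
    unfolding fourier_laplace_def by (rule integral_norm_bound)
  also have "\<dots> = (\<integral>y. exp (- Re z * y) \<partial>\<rho>)" by (simp add: norm_exp_eq_Re)
  also have "complex_of_real (\<integral>y. exp (- Re z * y) \<partial>\<rho>) = fourier_laplace \<rho> ?a"
    unfolding fourier_laplace_def
    by (subst integral_complex_of_real[symmetric]) (simp flip: exp_of_real)
  then have "(\<integral>y. exp (- Re z * y) \<partial>\<rho>) = 1 - Re (f ?a)"
    by (metis Re_complex_of_real minus_complex.simps(1) one_complex.simps(1) diff_diff_eq2 add_diff_cancel_left' )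
  finally have "Re (f ?a) \<le> 0" by simp
  moreover have "\<mu> * Re z - Re (f ?a) \<le> norm (f ?a - of_real \<mu> * ?a)"
    using abs_Re_le_cmod[of "f ?a - of_real \<mu> * ?a"] by simp
  moreover have "norm (f ?a - of_real \<mu> * ?a) \<le> Re z * (2 * s\<^sub>0 * D)"
    using f_near_0[of ?a] assms by simp
  moreover have "Re z * (2 * s\<^sub>0 * D) < Re z * \<mu>" using s0_D assms by simp
  ultimately show False by (simp add: mult.commute)
qed

text \<open>The integral of the nonnegative function \<open>1 - cos (b * y)\<close> vanishes, so
  \<open>exp (- \<i> * b * y)\<close> equals 1 almost surely, and so does its \<open>n\<close>-th
  power.\<close>

lemma f_zero_multiple:
  assumes "f (\<i> * of_real b) = 0"
  shows "f (\<i> * of_real (real n * b)) = 0"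
proof -
  have "(\<integral>y. 1 - cos (b * y) \<partial>\<rho>) = 0" using assms by (simp add: integral_one_minus_cos)
  then have "AE y in \<rho>. 1 - cos (b * y) = 0"
    using integral_nonneg_eq_0_iff_AE[OF integral_one_minus_cos(1)[of b]] by simp
  then have "AE y in \<rho>. exp (- (\<i> * of_real (real n * b)) * complex_of_real y) = 1"
  proof eventually_elim
    case (elim y)
    then have "exp (- (\<i> * of_real b) * complex_of_real y) = 1"
      using norm_exp_minus_one_sq[of b y] by simp
    then have "exp (of_nat n * (- (\<i> * of_real b) * complex_of_real y)) = 1"
      by (metis exp_of_nat_mult power_one)
    then show ?case by (simp add: mult_ac)
  qed
  then have "fourier_laplace \<rho> (\<i> * of_real (real n * b)) = (\<integral>y. 1 \<partial>\<rho>)"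
    unfolding fourier_laplace_def by (intro integral_cong_AE) auto
  then show ?thesis by (simp add: prob_space)
qed

section \<open>From the diophantine condition to a zero-free region\<close>

text \<open>Large \<bar>b\<bar> is covered by the hypothesis and the compact remainder by a positive
  minimum. The summand 1 matches the denominator of the region and lets the bound on the compact
  part pass through unweighted.\<close>

lemma weakly_diophantine_imp_lower_bound:
  assumes "weakly_diophantine l \<rho>" "0 \<le> l"
  shows "\<exists>c>0. \<forall>b. s\<^sub>0 \<le> \<bar>b\<bar> \<longrightarrow> c \<le> (1 + nonneg_power \<bar>b\<bar> l) * norm (f (\<i> * of_real b))"
proof -
  obtain c B where c: "c > 0"
    and B: "\<And>b. B \<le> \<bar>b\<bar> \<Longrightarrow> c \<le> nonneg_power \<bar>b\<bar> l * norm (f (\<i> * of_real b))"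
    using assms(1) unfolding weakly_diophantine_iff by blast
  have nz: "f (\<i> * of_real b) \<noteq> 0" if "b \<noteq> 0" for b
  proof
    assume b: "f (\<i> * of_real b) = 0"
    \<comment> \<open>A multiple of the supposed zero lies beyond the threshold \<open>B\<close>,
      where the lower bound \<open>c\<close> excludes zeros.\<close>
    obtain n :: nat where "B < real n * \<bar>b\<bar>" using ex_less_of_nat_mult[of "\<bar>b\<bar>" B] \<open>b \<noteq> 0\<close> by auto
    then have "c \<le> nonneg_power \<bar>real n * b\<bar> l * norm (f (\<i> * of_real (real n * b)))"
      by (intro B) (simp add: abs_mult)
    then show False using f_zero_multiple[OF b, of n] c by simp
  qed
  let ?g = "\<lambda>b. norm (f (\<i> * complex_of_real b))"
  let ?K = "{-B..-s\<^sub>0} \<union> {s\<^sub>0..B}"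
  have "D-lipschitz_on UNIV (\<lambda>b. f (\<i> * complex_of_real b))"
  proof (rule lipschitz_onI)
    fix a b :: real
    have "norm (f (\<i> * of_real a) - f (\<i> * of_real b)) \<le> norm (\<i> * of_real a - \<i> * complex_of_real b) * D"
      using s_pos by (intro f_lipschitz) auto
    also have "\<i> * of_real a - \<i> * complex_of_real b = \<i> * of_real (a - b)"
      by (simp add: algebra_simps)
    finally show "dist (f (\<i> * of_real a)) (f (\<i> * of_real b)) \<le> D * dist a b"
      by (simp only: dist_norm norm_mult norm_of_real norm_ii real_norm_def mult.commute mult_1)
  qed (use D_pos in simp)
  then have cont: "continuous_on ?K ?g"
    using lipschitz_on_continuous_on continuous_on_subset by (blast intro: continuous_on_norm)
  have "\<exists>\<delta>>0. \<forall>b\<in>?K. \<delta> \<le> ?g b"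
  proof (cases "?K = {}")
    case False
    have "compact ?K" by (intro compact_Un compact_Icc)
    then obtain x where x: "x \<in> ?K" "\<forall>b\<in>?K. ?g x \<le> ?g b"
      using continuous_attains_inf[OF _ False cont] by blast
    moreover have "0 < ?g x" using x(1) s0_pos nz[of x] by fastforce
    ultimately show ?thesis by blast
  qed (auto intro: exI[of _ 1])
  then obtain \<delta> where \<delta>: "\<delta> > 0" "\<And>b. b \<in> ?K \<Longrightarrow> \<delta> \<le> ?g b" by blast
  have "min c \<delta> \<le> (1 + nonneg_power \<bar>b\<bar> l) * ?g b" if b: "s\<^sub>0 \<le> \<bar>b\<bar>" for b
  proof (cases "B \<le> \<bar>b\<bar>")
    case True
    then show ?thesis using B[OF True] by (auto simp: distrib_right min_def intro: add_increasing)
  next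
    case False
    then have "\<delta> \<le> ?g b" using b by (intro \<delta>) auto
    moreover have "0 \<le> nonneg_power \<bar>b\<bar> l * ?g b" by (intro mult_nonneg_nonneg nonneg_power_nonneg) auto
    ultimately show ?thesis by (simp add: distrib_right)
  qed
  then show ?thesis using c \<delta>(1) by (intro exI[of _ "min c \<delta>"]) auto
qed

lemma weakly_diophantine_imp_zero_free:
  assumes "weakly_diophantine l \<rho>" "0 \<le> l"
  shows "\<exists>C>0. {z \<in> zero_free_region s\<^sub>0 C l. f z = 0} = {0}"
proof -
  obtain c where c: "c > 0"
    and lower: "\<And>b. s\<^sub>0 \<le> \<bar>b\<bar> \<Longrightarrow> c \<le> (1 + nonneg_power \<bar>b\<bar> l) * norm (f (\<i> * of_real b))"
    using weakly_diophantine_imp_lower_bound[OF assms] by blast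
  \<comment> \<open>Half of \<open>c / D\<close>, so that the final estimate reads
    \<open>c \<le> c / 2\<close>.\<close>
  define C where "C = c / (2 * D)"
  have C: "C > 0" using c D_pos by (simp add: C_def)
  have "z = 0" if z: "z \<in> zero_free_region s\<^sub>0 C l" "f z = 0" for z
  proof -
    let ?p = "1 + nonneg_power \<bar>Im z\<bar> l"
    have p: "?p > 0" using nonneg_power_nonneg[of "\<bar>Im z\<bar>" l] by simp
    have re: "\<bar>Re z\<bar> < s\<^sub>0" "- C / ?p \<le> Re z" using z(1) by (auto simp: zero_free_region_def)
    have "Re z \<le> 0" using f_nonzero_right[of z] z(2) re by force
    with re(2) have reC: "\<bar>Re z\<bar> * ?p \<le> C" using p by (simp add: field_simps)
    show "z = 0"
    proof (cases "\<bar>Im z\<bar> \<le> s\<^sub>0")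
      case True
      then have "norm z \<le> 2 * s\<^sub>0" using cmod_le[of z] re(1) by linarith
      then show ?thesis by (rule f_eq_0_near_0) (rule z(2))
    next
      case False
      have zi: "z - \<i> * of_real (Im z) = of_real (Re z)" by (simp add: complex_eq_iff)
      \<comment> \<open>The Lipschitz bound is applied between the zero \<open>z\<close> and its
        horizontal projection to the axis.\<close>
      have "norm (f (\<i> * of_real (Im z))) \<le> \<bar>Re z\<bar> * D"
      proof -
        have "norm (0 - f (\<i> * of_real (Im z))) \<le> \<bar>Re z\<bar> * D"
          using f_lipschitz[of z "\<i> * of_real (Im z)"] re(1) s0_le s0_pos
          unfolding z(2) zi norm_of_real by simp
        then show ?thesis by (simp only: diff_0 norm_minus_cancel)
      qed
      then have "?p * norm (f (\<i> * of_real (Im z))) \<le> ?p * (\<bar>Re z\<bar> * D)"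
        using p by (intro mult_left_mono) auto
      also have "\<dots> = \<bar>Re z\<bar> * ?p * D" by (simp only: mult_ac)
      also have "\<dots> \<le> C * D" using reC D_pos by (intro mult_right_mono) auto
      finally have "c \<le> C * D" using lower[of "Im z"] False by linarith
      moreover have "C * D = c / 2" using D_pos by (simp add: C_def)
      ultimately show ?thesis using c by linarith
    qed
  qed
  moreover have "0 \<in> zero_free_region s\<^sub>0 C l"
    using s0_pos C nonneg_power_nonneg[of 0 l] by (simp add: zero_free_region_def divide_nonneg_nonneg)
  ultimately have "{z \<in> zero_free_region s\<^sub>0 C l. f z = 0} = {0}"
    using f_zero by (intro equalityI subsetI) (simp_all only: mem_Collect_eq singleton_iff)
  then show ?thesis using C by blast
qed

section \<open>From a zero-free region to the diophantine condition\<close>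

lemma zero_free_imp_weakly_diophantine:
  assumes "C > 0" "{z \<in> zero_free_region s\<^sub>0 C l. f z = 0} = {0}" "0 \<le> l"
  shows "weakly_diophantine l \<rho>"
proof -
  \<comment> \<open>The three entries serve in turn to apply \<open>ex_zero_near\<close>, to keep
    the zero within \<open>s\<^sub>0\<close> of the axis, and to keep its height within 1 of
    \<open>b\<close>.\<close>
  define \<epsilon> where "\<epsilon> = min (\<mu>\<^sup>2 / (32 * D)) (min (\<mu> * s\<^sub>0 / 4) (\<mu> / 2))"
  define c where "c = min \<epsilon> (\<mu> * C / (2 * (1 + 2 powr l)))"
  have e: "\<epsilon> > 0" using drift_pos D_pos s0_pos by (simp add: \<epsilon>_def)
  have pw: "0 < 1 + 2 powr l" by (intro add_pos_nonneg) auto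
  have c: "c > 0" using e drift_pos assms(1) pw by (simp add: c_def)
  \<comment> \<open>With the height of the zero within 1 of \<open>b\<close>, the threshold 2
    ensures both that this zero is not 0 and that \<bar>Im z\<bar> is at most
    2\<bar>b\<bar>.\<close>
  have "c \<le> nonneg_power \<bar>b\<bar> l * norm (f (\<i> * of_real b))" if b: "2 \<le> \<bar>b\<bar>" for b
  proof -
    let ?n = "norm (f (\<i> * of_real b))"
    have p1: "1 \<le> nonneg_power \<bar>b\<bar> l" using b assms(3) by (intro nonneg_power_ge_one) auto
    show ?thesis
    proof (cases "?n \<le> \<epsilon>")
      case False
      then have "c \<le> ?n" by (simp add: c_def)
      also have "\<dots> \<le> nonneg_power \<bar>b\<bar> l * ?n" using p1 by (simp add: mult_le_cancel_right1)
      finally show ?thesis .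
    next
      case True
      then have n: "?n \<le> \<mu>\<^sup>2 / (32 * D)" "?n \<le> \<mu> * s\<^sub>0 / 4" "?n \<le> \<mu> / 2"
        by (auto simp: \<epsilon>_def)
      have r: "2 * ?n / \<mu> < s\<^sub>0" "2 * ?n / \<mu> \<le> 1"
      proof -
        have "2 * ?n < \<mu> * s\<^sub>0" using n(2) mult_pos_pos[OF drift_pos s0_pos] by linarith
        then show "2 * ?n / \<mu> < s\<^sub>0" using drift_pos by (simp add: field_simps)
        show "2 * ?n / \<mu> \<le> 1" using n(3) drift_pos by (simp add: field_simps)
      qed
      obtain z where z: "norm (z - \<i> * of_real b) \<le> 2 * ?n / \<mu>" "f z = 0"
        using ex_zero_near[of b] n(1) r(1) s0_le s0_pos by auto
      have re: "\<bar>Re z\<bar> \<le> 2 * ?n / \<mu>"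
        using order_trans[OF abs_Re_le_cmod z(1)] by simp
      have im: "\<bar>Im z - b\<bar> \<le> 1"
        using order_trans[OF abs_Im_le_cmod order_trans[OF z(1) r(2)]] by simp
      have "Im z \<noteq> 0" using im b by linarith
      then have "z \<noteq> 0" by auto
      then have "z \<notin> zero_free_region s\<^sub>0 C l" using assms(2) z(2) by blast
      \<comment> \<open>Since \<bar>Re z\<bar> is below \<open>s\<^sub>0\<close>, the zero can only
        leave the region through its curved left boundary.\<close>
      then have lt: "Re z < - C / (1 + nonneg_power \<bar>Im z\<bar> l)"
        using re r(1) by (auto simp: zero_free_region_def)
      let ?q = "1 + nonneg_power \<bar>Im z\<bar> l"
      have q: "0 < ?q" using nonneg_power_nonneg[of "\<bar>Im z\<bar>" l] by simp
      have "nonneg_power \<bar>Im z\<bar> l \<le> 2 powr l * nonneg_power \<bar>b\<bar> l"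
        using im b assms(3) by (intro nonneg_power_le_double) linarith+
      then have q2: "?q \<le> (1 + 2 powr l) * nonneg_power \<bar>b\<bar> l"
        using p1 by (simp add: distrib_right)
      have "C / ?q \<le> 2 * ?n / \<mu>" using lt re by simp
      then have "\<mu> * C \<le> 2 * ?n * ?q" using q drift_pos by (simp add: field_simps)
      also have "\<dots> \<le> 2 * ?n * ((1 + 2 powr l) * nonneg_power \<bar>b\<bar> l)"
        by (intro mult_left_mono q2) auto
      also have "\<dots> = (nonneg_power \<bar>b\<bar> l * ?n) * (2 * (1 + 2 powr l))" by (simp only: mult_ac)
      finally have "\<mu> * C / (2 * (1 + 2 powr l)) \<le> nonneg_power \<bar>b\<bar> l * ?n"
        using pw by (subst pos_divide_le_eq) auto
      then show ?thesis by (simp add: c_def)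
    qed
  qed
  then show ?thesis unfolding weakly_diophantine_iff using c by blast
qed

end

section \<open>Moment bounds from the exponential moment, and assembly\<close>

text \<open>Halving the order splits \<open>exp (\<eta> * \<bar>y\<bar>)\<close> into two equal
  factors; by the Taylor lower bound one of them absorbs \<open>\<bar>y\<bar>\<close> or
  \<open>y\<^sup>2\<close> up to a constant.\<close>

lemma drift_measure_of_exponential_moment:
  fixes \<rho> :: "real measure" and \<eta> :: real
  assumes "prob_space \<rho>" and sets[measurable_cong]: "sets \<rho> = sets borel"
    and eta: "\<eta> > 0" and "exponential_moment \<rho> \<eta>"
    and "(\<integral>y. y \<partial>\<rho>) > 0"
  shows "\<exists>D. drift_measure \<rho> (\<eta> / 2) D (\<integral>y. y \<partial>\<rho>)"
proof -
  interpret prob_space \<rho> by fact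
  define s where "s = \<eta> / 2"
  have s: "s > 0" using eta by (simp add: s_def)
  have i: "integrable \<rho> (\<lambda>y. exp (\<eta> * \<bar>y\<bar>))"
    using assms(4) by (intro integrableI_nonneg) (auto simp: exponential_moment_def)
  have split: "exp (\<eta> * \<bar>y\<bar>) = exp (s * \<bar>y\<bar>) * exp (s * \<bar>y\<bar>)" for y
    by (simp add: s_def flip: exp_add)
  have taylor: "1 + s * \<bar>y\<bar> + (s * \<bar>y\<bar>)\<^sup>2 / 2 \<le> exp (s * \<bar>y\<bar>)" for y
    using s by (intro exp_lower_Taylor_quadratic) auto
  have nn: "0 \<le> s * \<bar>y\<bar>" for y :: real using s by simp
  have i0: "integrable \<rho> (\<lambda>y. exp (s * \<bar>y\<bar>))"
    by (rule Bochner_Integration.integrable_bound[OF i]) (use s eta in \<open>auto simp: s_def intro!: mult_right_mono\<close>)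
  have i1: "integrable \<rho> (\<lambda>y. \<bar>y\<bar> * exp (s * \<bar>y\<bar>))"
  proof (rule Bochner_Integration.integrable_bound[OF integrable_mult_right[OF i, of "1 / s"]])
    have "\<bar>y\<bar> * exp (s * \<bar>y\<bar>) \<le> 1 / s * exp (\<eta> * \<bar>y\<bar>)" for y
    proof -
      have "s * \<bar>y\<bar> \<le> exp (s * \<bar>y\<bar>)" using taylor[of y] zero_le_power2[of "s * \<bar>y\<bar>"] by linarith
      then have "\<bar>y\<bar> \<le> 1 / s * exp (s * \<bar>y\<bar>)" using s by (simp add: field_simps)
      then show ?thesis unfolding split by (simp only: mult.assoc[symmetric] mult_right_mono exp_ge_zero)
    qed
    then show "AE y in \<rho>. norm (\<bar>y\<bar> * exp (s * \<bar>y\<bar>)) \<le> norm (1 / s * exp (\<eta> * \<bar>y\<bar>))"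
      using s by (auto simp: abs_mult)
  qed simp
  have i2: "integrable \<rho> (\<lambda>y. y\<^sup>2 * exp (s * \<bar>y\<bar>))"
  proof (rule Bochner_Integration.integrable_bound[OF integrable_mult_right[OF i, of "2 / s\<^sup>2"]])
    have "y\<^sup>2 * exp (s * \<bar>y\<bar>) \<le> 2 / s\<^sup>2 * exp (\<eta> * \<bar>y\<bar>)" for y
    proof -
      have "(s * \<bar>y\<bar>)\<^sup>2 / 2 \<le> exp (s * \<bar>y\<bar>)" using taylor[of y] nn[of y] by linarith
      then have "y\<^sup>2 \<le> 2 / s\<^sup>2 * exp (s * \<bar>y\<bar>)" using s by (simp add: field_simps power_mult_distrib)
      then show ?thesis unfolding split by (simp only: mult.assoc[symmetric] mult_right_mono exp_ge_zero)
    qed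
    then show "AE y in \<rho>. norm (y\<^sup>2 * exp (s * \<bar>y\<bar>)) \<le> norm (2 / s\<^sup>2 * exp (\<eta> * \<bar>y\<bar>))"
      using s by (auto simp: abs_mult)
  qed simp
  \<comment> \<open>The summand 1 makes \<open>D\<close> strictly positive even without a lower
    bound on the moments.\<close>
  define D where "D = 1 + (\<integral>y. \<bar>y\<bar> * exp (s * \<bar>y\<bar>) \<partial>\<rho>) + (\<integral>y. y\<^sup>2 * exp (s * \<bar>y\<bar>) \<partial>\<rho>)"
  have "0 \<le> (\<integral>y. \<bar>y\<bar> * exp (s * \<bar>y\<bar>) \<partial>\<rho>)" "0 \<le> (\<integral>y. y\<^sup>2 * exp (s * \<bar>y\<bar>) \<partial>\<rho>)"
    by (auto intro!: integral_nonneg_AE)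
  then have D: "0 < D" "(\<integral>y. \<bar>y\<bar> * exp (s * \<bar>y\<bar>) \<partial>\<rho>) \<le> D"
      "(\<integral>y. y\<^sup>2 * exp (s * \<bar>y\<bar>) \<partial>\<rho>) \<le> D"
    unfolding D_def by linarith+
  have "drift_measure \<rho> s D (\<integral>y. y \<partial>\<rho>)"
    by (intro drift_measure.intro drift_measure_axioms.intro assms(1) sets s D(1) assms(5) refl
        i0 i1 i2 D(2,3))
  then show ?thesis unfolding s_def by blast
qed

theorem proposition2p18:
  fixes \<rho> :: "real measure" and \<eta> :: real
  assumes "prob_space \<rho>" and "sets \<rho> = sets borel"
    and "\<eta> > 0" and "exponential_moment \<rho> \<eta>"
    and "(\<integral>y. y \<partial>\<rho>) > 0"
  shows "\<exists>s\<^sub>0::real. 0 < s\<^sub>0 \<and> s\<^sub>0 \<le> \<eta> \<and>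
    (\<forall>l::real. l \<ge> 0 \<longrightarrow>
      (weakly_diophantine l \<rho> \<longleftrightarrow>
        (\<exists>C::real. C > 0 \<and>
          {z \<in> zero_free_region s\<^sub>0 C l. 1 - fourier_laplace \<rho> z = 0} = {0})))"
proof -
  obtain D where "drift_measure \<rho> (\<eta> / 2) D (\<integral>y. y \<partial>\<rho>)"
    using drift_measure_of_exponential_moment[OF assms] by blast
  then interpret drift_measure \<rho> "\<eta> / 2" D "\<integral>y. y \<partial>\<rho>" .
  show ?thesis
  proof (rule exI[of _ s\<^sub>0], intro conjI allI impI)
    show "0 < s\<^sub>0" by (rule s0_pos)
    show "s\<^sub>0 \<le> \<eta>" using s0_le s0_pos by simp
    show "weakly_diophantine l \<rho> \<longleftrightarrow> (\<exists>C>0. {z \<in> zero_free_region s\<^sub>0 C l. f z = 0} = {0})"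
      if "0 \<le> l" for l
      using weakly_diophantine_imp_zero_free[OF _ that] zero_free_imp_weakly_diophantine[OF _ _ that]
      by blast
  qed
qed

end
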